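(* Let $\mathcal{F}:\mathcal{P}(\mathbb{R}^d)\to\mathbb{R}$ be an energy functional with smooth first variation, let $\rho_*$ be the Gibbs distribution, and suppose $\mathcal{F}$ satisfies the Polyak–Łojasiewicz inequality $$\frac1\zeta\int_{\mathbb{R}^d}\left|\nabla_X\frac{\delta\mathcal{F}}{\delta\rho}(\rho,x)\right|^2\rho(x)\,dx\ \ge\ \mathcal{F}(\rho)-\mathcal{F}(\rho_* )\qquad\text{for all }\rho\in\mathcal{P}(\mathbb{R}^d),$$ where $\zeta$ is a positive constant. Let $\theta(t)$ be the solution of the parameterized Wasserstein gradient flow $$\dot\theta=-\widehat G(\theta)^\dagger\nabla_\theta F(\theta)$$ with initial value $\theta(0)$. Then, for $t\ge 0$, $$\mathcal{F}(\rho_{\theta(t)})-\mathcal{F}(\rho_* )\le\frac{\delta_0}{\zeta}\left(1-e^{-\zeta t}\right)+\big(\mathcal{F}(\rho_{\theta(0)})-\mathcal{F}(\rho_* )\big)e^{-\zeta t},$$ where $\delta_0$ is the projection error.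
   Context: Throughout the state space is $\mathbb{R}^d$, and $\mathcal{P}(\mathbb{R}^d)$ is the set of probability densities $\rho$ on $\mathbb{R}^d$ with $\int|x|^2\rho(x)\,dx<\infty$. For a smooth functional $\mathcal{F}$ on $\mathcal{P}(\mathbb{R}^d)$, $\frac{\delta}{\delta\rho}\mathcal{F}(\rho,x)$ denotes its first variation (in the $L^2$ sense) at $\rho$ evaluated at the point $x$, and $\nabla_X$ (also written $\nabla$) is the gradient in $x$. The expression $\nabla_X\frac{\delta}{\delta\rho}\mathcal{F}(T_\sharp\varrho(\cdot),\cdot)\circ T(z)$ means the $x$-gradient of the first variation at the density $T_\sharp\varrho$, evaluated at $x=T(z)$. The Gibbs distribution $\rho_*\in\mathcal{P}(\mathbb{R}^d)$ is the target (equilibrium) density of the Wasserstein gradient flow $\partial_t\rho=\nabla\cdot(\rho\nabla\frac{\delta\mathcal{F}}{\delta\rho})$ of $\mathcal{F}$; for example, when $\mathcal{F}(\rho)=\int V\rho\,dx+D\int\rho\log\rho\,dx+D\log Z_D$ with $V\in C^2$ and $D>0$, it is $\rho_*(x)=e^{-V(x)/D}/Z_D$ with $Z_D=\int e^{-V(x)/D}\,dx$. Reference measure: $\lambda$ is a fixed probability measure on $\mathbb{R}^d$, absolutely continuous with respect to Lebesgue measure, with density $\varrho$. For a map $T:\mathbb{R}^d\to\mathbb{R}^d$, the push-forward density $T_\sharp\varrho$ is given by $\int_E T_\sharp\varrho\,dx=\lambda(T^{-1}(E))$ for measurable $E$. Parameterization: $\Theta\subset\mathbb{R}^n$ is the parameter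 space; for each $\theta\in\Theta$, $T_\theta:\mathbb{R}^d\to\mathbb{R}^d$ is a push-forward map, with $(\theta,z)\mapsto T_\theta(z)$ of class $C^1$; $\rho_\theta=T_{\theta\sharp}\varrho\in\mathcal{P}(\mathbb{R}^d)$; $\partial_\theta T_\theta(z)\in\mathbb{R}^{d\times n}$ is the Jacobian in $\theta$. Define $$\widehat G(\theta)=\int\partial_\theta T_\theta(z)^\top\partial_\theta T_\theta(z)\,d\lambda(z)\in\mathbb{R}^{n\times n},$$ with Moore–Penrose pseudoinverse $\widehat G(\theta)^\dagger$, and $F(\theta)=\mathcal{F}(\rho_\theta)$, whose gradient is given by $$\nabla_\theta F(\theta)=\int\partial_\theta T_\theta(z)^\top\,\nabla_X\frac{\delta}{\delta\rho}\mathcal{F}(T_{\theta\sharp}\varrho(\cdot),\cdot)\circ T_\theta(z)\,d\lambda(z).$$ Projection error (here the cotangent space of $\Theta$ at $\theta$ is identified with $\mathbb{R}^n$): $$\delta_0=\sup_{\theta\in\Theta}\min_{\xi\in\mathbb{R}^n}\int\left|\nabla\frac{\delta}{\delta\rho}\mathcal{F}(T_{\theta\sharp}\varrho(\cdot),\cdot)\circ T_\theta(z)-\partial_\theta T_\theta(z)\,\xi\right|^2d\lambda(z).$$ *)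

theory Defs
  imports "HOL-Probability.Probability"
begin

definition grad :: "('a::real_inner \<Rightarrow> real) \<Rightarrow> 'a \<Rightarrow> 'a" where
  "grad f x = (THE D. GDERIV f x :> D)"

definition C1_fun :: "('a::euclidean_space \<Rightarrow> real) \<Rightarrow> bool" where
  "C1_fun f \<longleftrightarrow> (\<forall>x. f differentiable (at x)) \<and> continuous_on UNIV (grad f)"

definition prob_densities :: "(real^'d \<Rightarrow> real) set" where
  "prob_densities = {\<rho>. \<rho> \<in> borel_measurable borel \<and> (\<forall>x. 0 \<le> \<rho> x) \<and>
     integrable lborel \<rho> \<and> (\<integral>x. \<rho> x \<partial>lborel) = 1 \<and>
     integrable lborel (\<lambda>x. (norm x)\<^sup>2 * \<rho> x)}"

text \<open>The function \<open>\<phi>\<close> is an \<open>L\<^sup>2\<close> first variation of \<open>\<F>\<close> at \<open>\<rho>\<close>.  Since \<open>\<rho>\<close> may vanish, the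
  perturbation \<open>\<rho> + \<epsilon>h\<close> is only required to be a density for small positive \<open>\<epsilon>\<close>, and the derivative
  at 0 is one-sided; this forces \<open>\<integral>h = 0\<close>, so \<open>\<phi>\<close> is determined up to an additive constant (and
  a null set).  With bounded, boundedly supported \<open>h\<close>, the pairing \<open>\<integral>\<phi>h\<close> converges for every
  continuous \<open>\<phi>\<close>.\<close>

definition first_variation ::
    "((real^'d \<Rightarrow> real) \<Rightarrow> real) \<Rightarrow> (real^'d \<Rightarrow> real) \<Rightarrow> (real^'d \<Rightarrow> real) \<Rightarrow> bool" where
  "first_variation \<F> \<rho> \<phi> \<longleftrightarrow>
     (\<forall>h. h \<in> borel_measurable borel \<and> bounded (range h) \<and> bounded {x. h x \<noteq> 0} \<and>
        (\<forall>\<^sub>F \<epsilon> in at_right 0. (\<lambda>x. \<rho> x + \<epsilon> * h x) \<in> prob_densities) \<longrightarrow>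
        ((\<lambda>\<epsilon>. \<F> (\<lambda>x. \<rho> x + \<epsilon> * h x)) has_real_derivative (\<integral>x. \<phi> x * h x \<partial>lborel))
          (at_right 0))"

text \<open>A density \<open>\<rho>\<close> is an equilibrium of \<open>\<partial>\<^sub>t\<rho> = \<nabla>\<cdot>(\<rho>\<nabla>\<phi>)\<close>, \<open>\<phi> = \<delta>\<F>/\<delta>\<rho>\<close>, when \<open>\<nabla>\<cdot>(\<rho>\<nabla>\<phi>) = 0\<close> holds
  weakly.  For the locally integrable field \<open>\<rho>\<nabla>\<phi>\<close> it makes no difference whether the test
  functions are smooth or merely \<open>C\<^sup>1\<close>.\<close>

definition gibbs_distribution ::
    "((real^'d \<Rightarrow> real) \<Rightarrow> real^'d \<Rightarrow> real) \<Rightarrow> (real^'d \<Rightarrow> real) \<Rightarrow> bool" where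
  "gibbs_distribution \<phi> \<rho> \<longleftrightarrow> \<rho> \<in> prob_densities \<and>
     (\<forall>\<psi>. C1_fun \<psi> \<and> bounded {x. \<psi> x \<noteq> 0} \<longrightarrow>
        (\<integral>x. (grad (\<phi> \<rho>) x \<bullet> grad \<psi> x) * \<rho> x \<partial>lborel) = 0)"

text \<open>The inequality lives in \<^typ>\<open>ereal\<close>: the dissipation integral may be infinite, and
  \<open>\<F> \<rho> - \<F> \<rho>\<^sub>*\<close> is not presupposed to be nonnegative.\<close>

definition PL_inequality ::
    "((real^'d \<Rightarrow> real) \<Rightarrow> real) \<Rightarrow> ((real^'d \<Rightarrow> real) \<Rightarrow> real^'d \<Rightarrow> real) \<Rightarrow>
     (real^'d \<Rightarrow> real) \<Rightarrow> real \<Rightarrow> bool" where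
  "PL_inequality \<F> \<phi> \<rho>s \<zeta> \<longleftrightarrow>
     (\<forall>\<rho>\<in>prob_densities.
        ereal (1 / \<zeta>) * enn2ereal (\<integral>\<^sup>+x. ennreal ((norm (grad (\<phi> \<rho>) x))\<^sup>2 * \<rho> x) \<partial>lborel)
          \<ge> ereal (\<F> \<rho> - \<F> \<rho>s))"

definition pushforward_density ::
    "(real^'d) measure \<Rightarrow> (real^'d \<Rightarrow> real^'d) \<Rightarrow> (real^'d \<Rightarrow> real) \<Rightarrow> bool" where
  "pushforward_density M T \<rho> \<longleftrightarrow>
     (\<forall>E\<in>sets borel. (LINT x:E|lborel. \<rho> x) = measure M (T -` E))"

text \<open>\<open>(\<theta>, z) \<mapsto> T\<^sub>\<theta>(z)\<close> is \<open>C\<^sup>1\<close> on \<open>\<Theta> \<times> \<real>\<^sup>d\<close> and \<open>J \<theta> z\<close> is its Jacobian matrix in \<open>\<theta>\<close>.  Derivatives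
  are taken within \<open>\<Theta>\<close>, which need not be open; for open \<open>\<Theta>\<close> they are the usual derivatives
  and \<open>J\<close> is uniquely determined.\<close>

definition C1_parameterization ::
    "(real^'n) set \<Rightarrow> (real^'n \<Rightarrow> real^'d \<Rightarrow> real^'d) \<Rightarrow> (real^'n \<Rightarrow> real^'d \<Rightarrow> real^'n^'d) \<Rightarrow> bool"
  where
  "C1_parameterization \<Theta> T J \<longleftrightarrow>
     (\<exists>D :: (real^'n) \<times> (real^'d) \<Rightarrow> ((real^'n) \<times> (real^'d)) \<Rightarrow>\<^sub>L (real^'d).
        continuous_on (\<Theta> \<times> UNIV) D \<and>
        (\<forall>\<theta>\<in>\<Theta>. \<forall>z.
           ((\<lambda>(\<theta>, z). T \<theta> z) has_derivative blinfun_apply (D (\<theta>, z)))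
             (at (\<theta>, z) within \<Theta> \<times> UNIV) \<and>
           J \<theta> z = matrix (\<lambda>h. blinfun_apply (D (\<theta>, z)) (h, 0))))"

text \<open>The four Penrose conditions; over the reals the adjoint is the transpose.\<close>

definition is_pseudoinverse :: "real^'n^'m \<Rightarrow> real^'m^'n \<Rightarrow> bool" where
  "is_pseudoinverse A B \<longleftrightarrow> A ** B ** A = A \<and> B ** A ** B = B \<and>
     transpose (A ** B) = A ** B \<and> transpose (B ** A) = B ** A"

definition pseudoinverse :: "real^'n^'m \<Rightarrow> real^'m^'n" where
  "pseudoinverse A = (THE B. is_pseudoinverse A B)"

definition Ghat ::
    "(real^'d) measure \<Rightarrow> (real^'n \<Rightarrow> real^'d \<Rightarrow> real^'n^'d) \<Rightarrow> real^'n \<Rightarrow> real^'n^'n" where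
  "Ghat M J \<theta> = (\<integral>z. transpose (J \<theta> z) ** J \<theta> z \<partial>M)"

text \<open>In the next two definitions \<open>r \<theta>\<close> is the density \<open>\<rho>\<^sub>\<theta>\<close>, and \<open>\<phi> \<rho>\<close> is the first variation
  at \<open>\<rho>\<close>.\<close>

definition param_gradient ::
    "(real^'d) measure \<Rightarrow> ((real^'d \<Rightarrow> real) \<Rightarrow> real^'d \<Rightarrow> real) \<Rightarrow>
     (real^'n \<Rightarrow> real^'d \<Rightarrow> real^'d) \<Rightarrow> (real^'n \<Rightarrow> real^'d \<Rightarrow> real^'n^'d) \<Rightarrow>
     (real^'n \<Rightarrow> real^'d \<Rightarrow> real) \<Rightarrow> real^'n \<Rightarrow> real^'n" where
  "param_gradient M \<phi> T J r \<theta> =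
     (\<integral>z. transpose (J \<theta> z) *v grad (\<phi> (r \<theta>)) (T \<theta> z) \<partial>M)"

text \<open>The projection error may be infinite.  The inner infimum is always a minimum, being a
  least-squares problem over the finite-dimensional space of \<open>\<xi>\<close>.\<close>

definition projection_error ::
    "(real^'d) measure \<Rightarrow> ((real^'d \<Rightarrow> real) \<Rightarrow> real^'d \<Rightarrow> real) \<Rightarrow> (real^'n) set \<Rightarrow>
     (real^'n \<Rightarrow> real^'d \<Rightarrow> real^'d) \<Rightarrow> (real^'n \<Rightarrow> real^'d \<Rightarrow> real^'n^'d) \<Rightarrow>
     (real^'n \<Rightarrow> real^'d \<Rightarrow> real) \<Rightarrow> ennreal" where
  "projection_error M \<phi> \<Theta> T J r =
     (SUP \<theta>\<in>\<Theta>. INF \<xi>. \<integral>\<^sup>+z. ennreal ((norm (grad (\<phi> (r \<theta>)) (T \<theta> z) - J \<theta> z *v \<xi>))\<^sup>2) \<partial>M)"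

end

theory Submission imports Defs begin

text \<open>
  Write \<open>y t = \<F> (r (\<theta> t)) - \<F> \<rho>s\<close>, and at a fixed \<open>\<eta> = \<theta> t\<close> let \<open>v\<close> be the Wasserstein gradient field
  \<open>grad (\<phi> (r \<eta>)) \<circ> T \<eta>\<close>, \<open>g\<close> the parameter gradient and \<open>G\<close> the metric \<open>Ghat M J \<eta>\<close>.  The chain
  rule gives \<open>y' = - g \<bullet> G\<^sup>\<dagger> g\<close>.  The whole point is that this dissipation is the dissipation
  \<open>\<integral>|v|\<^sup>2\<close> of the exact gradient flow up to the projection error: \<open>G\<close> is the Gram matrix of the
  columns of the Jacobian in \<open>L\<^sup>2(M)\<close> and \<open>g\<close> is the vector of their inner products with \<open>v\<close>, so
  \<open>G\<^sup>\<dagger> g\<close> solves the normal equations of the least-squares approximation of \<open>v\<close> by \<open>J \<eta> z *v \<xi>\<close>,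
  and by Pythagoras the least error is \<open>\<integral>|v|\<^sup>2 - g \<bullet> G\<^sup>\<dagger> g\<close>
  (\<open>least_squares_lower_bound\<close>).  Hence \<open>y' \<le> \<delta>\<^sub>0 - \<integral>|v|\<^sup>2\<close>.

  Changing variables along the push-forward turns \<open>\<integral>|v|\<^sup>2\<close> into the dissipation integral of the
  Polyak-Lojasiewicz inequality at \<open>r \<eta>\<close>, so \<open>\<integral>|v|\<^sup>2 \<ge> \<zeta> y\<close> (\<open>projected_dissipation\<close>).  The resulting
  inequality \<open>y' \<le> \<delta>\<^sub>0 - \<zeta> y\<close> integrates to the claim (\<open>gronwall_affine\<close>).

  Two points need care.  The normal equations are solvable although \<open>G\<close> may be singular: a vector
  in the kernel of \<open>G\<close> is annihilated by the Jacobian almost everywhere, so \<open>g\<close> is orthogonal to it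
  (\<open>normal_equations\<close>, \<open>pseudoinverse_solves\<close>).  And the field \<open>v\<close> belongs to
  \<open>L\<^sup>2(M)\<close> by finiteness of the projection error (\<open>square_integrable_of_finite_error\<close>).  If that
  error is infinite, the bound is trivial for \<open>t > 0\<close>, and at \<open>t = 0\<close> it is an equality
  because \<open>\<infinity> * 0 = 0\<close> in \<^typ>\<open>ereal\<close>.
\<close>

section \<open>The pseudoinverse of a symmetric matrix\<close>

lemma matrix_mult_diff_left: "(A :: real^'m^'k) ** (B - C) = A ** B - A ** C"
  by (simp add: matrix_matrix_mult_def vec_eq_iff sum_subtractf algebra_simps)

lemma matrix_mult_diff_right: "((A :: real^'m^'k) - B) ** C = A ** C - B ** C"
  by (simp add: matrix_matrix_mult_def vec_eq_iff sum_subtractf algebra_simps)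

lemma matrix_mult_add_right: "((A :: real^'m^'k) + B) ** C = A ** C + B ** C"
  by (simp add: matrix_matrix_mult_def vec_eq_iff sum.distrib algebra_simps)

lemma transpose_diff: "transpose ((A :: real^'m^'k) - B) = transpose A - transpose B"
  by (simp add: transpose_def vec_eq_iff)

lemma inner_transpose_mult: "(transpose (A :: real^'m^'k) *v v) \<bullet> x = v \<bullet> (A *v x)"
  by (simp add: dot_lmul_matrix)

text \<open>The orthogonal projection onto the kernel, built from an orthonormal basis of it.  It is
  annihilated by \<open>G\<close> from both sides because \<open>G ** Q = 0\<close> can be transposed.\<close>

lemma symmetric_kernel_projection:
  fixes G :: "real^'n^'n"
  assumes sym: "transpose G = G"
  obtains Q where "transpose Q = Q" "Q ** Q = Q" "G ** Q = 0" "Q ** G = 0"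
    "\<And>x. G *v x = 0 \<Longrightarrow> Q *v x = x"
proof -
  define S where "S = {x. G *v x = 0}"
  have "subspace S"
    by (auto simp: S_def subspace_def matrix_vector_right_distrib matrix_vector_mult_scaleR)
  then obtain B where B: "B \<subseteq> S" "pairwise orthogonal B" "\<And>x. x \<in> B \<Longrightarrow> norm x = 1"
      "independent B" "span B = S"
    by (metis orthonormal_basis_subspace)
  have fin: "finite B" using B(4) independent_imp_finite by blast
  define p where "p x = (\<Sum>b\<in>B. (b \<bullet> x) *\<^sub>R b)" for x :: "real^'n"
  have lin: "linear p"
    by (rule linearI)
      (simp_all add: p_def inner_right_distrib scaleR_left_distrib sum.distrib scaleR_right.sum)
  define Q where "Q = matrix p"
  have Q: "Q *v x = p x" for x unfolding Q_def using lin by (simp add: matrix_works)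
  have pS: "p x \<in> S" for x
    unfolding p_def using B(1) \<open>subspace S\<close>
    by (auto intro!: subspace_sum subspace_scale)
  have p_basis: "p b = b" if "b \<in> B" for b
  proof -
    have "(c \<bullet> b) *\<^sub>R c = (if c = b then b else 0)" if "c \<in> B" for c
      using B(2,3) \<open>b \<in> B\<close> that
      by (auto simp: pairwise_def orthogonal_def norm_eq_1)
    then show ?thesis using fin that by (simp add: p_def)
  qed
  have fix_S: "p x = x" if "x \<in> S" for x
  proof (rule linear_eq_on_span[where g = "\<lambda>x. x" and B = B])
    show "x \<in> span B" using that B(5) by simp
  qed (use lin p_basis in \<open>auto simp: linear_id[unfolded id_def]\<close>)
  have p_sym: "p x \<bullet> y = x \<bullet> p y" for x y
    by (simp add: p_def inner_sum_left inner_sum_right inner_commute mult.commute)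
  have sQ: "transpose Q = Q"
  proof -
    have "transpose Q *v x = Q *v x" for x
    proof (rule vector_eq_rdot[THEN iffD1], intro allI)
      fix y show "(transpose Q *v x) \<bullet> y = (Q *v x) \<bullet> y"
        unfolding inner_transpose_mult by (simp add: Q p_sym)
    qed
    then show ?thesis by (simp add: matrix_eq)
  qed
  have GQ: "G ** Q = 0"
    using pS by (simp add: matrix_eq matrix_vector_mul_assoc[symmetric] Q S_def)
  show thesis
  proof (rule that[of Q])
    show "Q ** Q = Q"
      using pS fix_S by (simp add: matrix_eq matrix_vector_mul_assoc[symmetric] Q)
    show "Q ** G = 0"
      using arg_cong[OF GQ, of transpose]
      by (simp add: matrix_transpose_mul sQ sym) (simp add: transpose_def vec_eq_iff)
  qed (use sQ GQ fix_S in \<open>auto simp: Q S_def\<close>)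
qed

text \<open>Adding to \<open>G\<close> the orthogonal projection \<open>Q\<close> onto its kernel makes it invertible, since \<open>G\<close> and
  \<open>Q\<close> act on complementary invariant subspaces.  On the kernel the inverse is the identity, so
  subtracting \<open>Q\<close> again leaves the inverse of \<open>G\<close> on its range and zero on its kernel.\<close>

lemma symmetric_has_pseudoinverse:
  fixes G :: "real^'n^'n"
  assumes sym: "transpose G = G"
  shows "\<exists>B. is_pseudoinverse G B"
proof -
  obtain Q where Q: "transpose Q = Q" "Q ** Q = Q" "G ** Q = 0" "Q ** G = 0"
      and ker: "\<And>x. G *v x = 0 \<Longrightarrow> Q *v x = x"
    using symmetric_kernel_projection[OF sym] by blast
  define H where "H = G + Q"
  have G: "G = H - Q" by (simp add: H_def)
  have HQ: "H ** Q = Q" and QH: "Q ** H = Q"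
    using Q by (simp_all add: H_def matrix_mult_add_right matrix_add_ldistrib)
  have "x = 0" if x: "H *v x = 0" for x
  proof -
    have "Q *v x = Q *v (H *v x)" by (simp add: matrix_vector_mul_assoc QH)
    then have Qx: "Q *v x = 0" using x by simp
    then have "G *v x = 0" using x by (simp add: H_def matrix_vector_mult_add_rdistrib)
    with Qx ker show ?thesis by metis
  qed
  then obtain K where KH: "K ** H = mat 1"
    using matrix_left_invertible_ker by blast
  then have HK: "H ** K = mat 1" using matrix_left_right_inverse by blast
  have KQ: "K ** Q = Q"
    using arg_cong[OF HQ, of "(**) K"] KH by (simp add: matrix_mul_assoc)
  have QK: "Q ** K = Q"
    using arg_cong[OF QH, of "\<lambda>X. X ** K"] HK by (simp add: matrix_mul_assoc[symmetric])
  define B where "B = K - Q"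
  have GB: "G ** B = mat 1 - Q" and BG: "B ** G = mat 1 - Q"
    unfolding G B_def using HK KH HQ QH KQ QK Q(2)
    by (simp_all add: matrix_mult_diff_left matrix_mult_diff_right)
  have "is_pseudoinverse G B"
    unfolding is_pseudoinverse_def GB BG
    using Q KQ QK
    by (simp add: matrix_mult_diff_right transpose_diff)
      (simp add: B_def matrix_mult_diff_left)
  then show ?thesis ..
qed

text \<open>Both \<open>A ** B\<close> and \<open>A ** C\<close> are the orthogonal projection onto the range of \<open>A\<close>, and both
  \<open>B ** A\<close> and \<open>C ** A\<close> the one onto the orthogonal complement of its kernel; and
  \<open>B = B ** A ** B\<close> is determined by these two products.\<close>

lemma pseudoinverse_unique:
  assumes B: "is_pseudoinverse A B" and C: "is_pseudoinverse A C"
  shows "B = C"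
proof -
  note b = B[unfolded is_pseudoinverse_def] and c = C[unfolded is_pseudoinverse_def]
  have "A ** B = transpose (A ** B)" using b by simp
  also have "\<dots> = transpose ((A ** C) ** (A ** B))" using c by (simp add: matrix_mul_assoc)
  also have "\<dots> = (A ** B) ** (A ** C)" using b c by (simp add: matrix_transpose_mul)
  also have "\<dots> = A ** C" using b by (simp add: matrix_mul_assoc)
  finally have AB: "A ** B = A ** C" .
  have "B ** A = transpose (B ** A)" using b by simp
  also have "\<dots> = transpose ((B ** A) ** (C ** A))"
    using c by (simp add: matrix_mul_assoc[symmetric])
  also have "\<dots> = (C ** A) ** (B ** A)" using b c by (simp add: matrix_transpose_mul)
  also have "\<dots> = C ** A" using b by (simp add: matrix_mul_assoc[symmetric])
  finally have BA: "B ** A = C ** A" .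
  have "B = (B ** A) ** B" using b by simp
  also have "\<dots> = C ** (A ** B)" by (simp add: BA matrix_mul_assoc)
  also have "\<dots> = C" using c by (simp add: AB matrix_mul_assoc)
  finally show ?thesis .
qed

lemma symmetric_pseudoinverse:
  fixes G :: "real^'n^'n"
  assumes "transpose G = G"
  shows "is_pseudoinverse G (pseudoinverse G)"
  unfolding pseudoinverse_def
  using symmetric_has_pseudoinverse[OF assms] pseudoinverse_unique by (metis theI)

text \<open>The matrix \<open>P = G ** pseudoinverse G\<close> is the orthogonal projection onto the range of \<open>G\<close>, which
  for symmetric \<open>G\<close> is the orthogonal complement of the kernel.  So the residual \<open>u = g - P *v g\<close> lies
  in the kernel of both \<open>G\<close> and \<open>P\<close>.  It is therefore orthogonal to \<open>g\<close> by hypothesis and to \<open>P *v g\<close>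
  by symmetry of \<open>P\<close>, hence to itself.\<close>

lemma pseudoinverse_solves:
  fixes G :: "real^'n^'n"
  assumes sym: "transpose G = G"
    and g: "\<And>u. G *v u = 0 \<Longrightarrow> g \<bullet> u = 0"
  shows "G *v (pseudoinverse G *v g) = g"
proof -
  define P where "P = G ** pseudoinverse G"
  have GPG: "P ** G = G" and symP: "transpose P = P"
    using symmetric_pseudoinverse[OF sym] by (auto simp: is_pseudoinverse_def P_def)
  have PP: "P ** P = P"
    unfolding P_def using GPG[unfolded P_def] by (simp add: matrix_mul_assoc)
  have GP: "G ** P = G"
    using arg_cong[OF GPG, of transpose] by (simp add: matrix_transpose_mul sym symP)
  define u where "u = g - P *v g"
  have "G *v u = 0" "P *v u = 0"
    by (simp_all add: u_def matrix_vector_mult_diff_distrib matrix_vector_mul_assoc GP PP)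
  have "u \<bullet> (P *v g) = (transpose P *v u) \<bullet> g" by (simp only: inner_transpose_mult)
  also have "\<dots> = 0" using \<open>P *v u = 0\<close> by (simp only: symP inner_zero_left)
  finally have "u \<bullet> u = 0"
    using g[OF \<open>G *v u = 0\<close>] by (simp add: u_def[symmetric] inner_commute[of u g]
        inner_diff_right[of u g "P *v g", folded u_def])
  then show ?thesis by (simp add: u_def P_def matrix_vector_mul_assoc)
qed

section \<open>Least squares in mean square\<close>

lemma borel_measurable_matrix_vector [measurable]:
  fixes A :: "'a \<Rightarrow> real^'n^'d"
  assumes "A \<in> borel_measurable N"
  shows "(\<lambda>z. A z *v x) \<in> borel_measurable N"
proof -
  have "continuous_on UNIV (\<lambda>A :: real^'n^'d. A *v x)"
    unfolding matrix_vector_mult_def by (intro continuous_intros)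
  then show ?thesis by (rule borel_measurable_continuous_on[OF _ assms])
qed

lemma bounded_linear_matrix_vector_left: "bounded_linear (\<lambda>A :: real^'n^'d. A *v x)"
  by (intro linear_conv_bounded_linear[THEN iffD1] linearI)
    (simp_all add: matrix_vector_mult_add_rdistrib scaleR_matrix_vector_assoc)

lemma abs_inner_le_squares: "\<bar>x \<bullet> y\<bar> \<le> (norm x)\<^sup>2 + (norm y)\<^sup>2"
proof -
  have "\<bar>x \<bullet> y\<bar> \<le> norm x * norm y" by (rule Cauchy_Schwarz_ineq2)
  also have "\<dots> \<le> (norm x)\<^sup>2 + (norm y)\<^sup>2"
    using sum_squares_bound[of "norm x" "norm y"] mult_nonneg_nonneg[OF norm_ge_zero norm_ge_zero, of x y]
    by linarith
  finally show ?thesis .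
qed

lemma integrable_inner_of_squares:
  fixes f g :: "'a \<Rightarrow> 'b::euclidean_space"
  assumes [measurable]: "f \<in> borel_measurable N" "g \<in> borel_measurable N"
    and "integrable N (\<lambda>z. (norm (f z))\<^sup>2)" "integrable N (\<lambda>z. (norm (g z))\<^sup>2)"
  shows "integrable N (\<lambda>z. f z \<bullet> g z)"
  by (rule Bochner_Integration.integrable_bound[OF Bochner_Integration.integrable_add[OF assms(3,4)]])
    (auto intro!: order_trans[OF abs_inner_le_squares])

text \<open>A matrix-valued function \<open>A\<close> is viewed as a family of columns in \<open>L\<^sup>2(N)\<close>.  With \<open>A = J \<eta>\<close>
  and \<open>v = grad (\<phi> (r \<eta>)) \<circ> T \<eta>\<close> the next two definitions give the metric \<^const>\<open>Ghat\<close> and the parameter gradient.\<close>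

definition gram_matrix :: "'a measure \<Rightarrow> ('a \<Rightarrow> real^'n^'d) \<Rightarrow> real^'n^'n" where
  "gram_matrix N A = (\<integral>z. transpose (A z) ** A z \<partial>N)"

definition moment :: "'a measure \<Rightarrow> ('a \<Rightarrow> real^'n^'d) \<Rightarrow> ('a \<Rightarrow> real^'d) \<Rightarrow> real^'n" where
  "moment N A v = (\<integral>z. transpose (A z) *v v z \<partial>N)"

context
  fixes N :: "'a measure" and A :: "'a \<Rightarrow> real^'n^'d"
  assumes A_meas [measurable]: "A \<in> borel_measurable N"
    and gram: "integrable N (\<lambda>z. transpose (A z) ** A z)"
begin

lemma gram_pointwise: "(norm (A z *v x))\<^sup>2 = x \<bullet> ((transpose (A z) ** A z) *v x)"
  by (simp only: power2_norm_eq_inner matrix_vector_mul_assoc[symmetric]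
      inner_commute[of x] inner_transpose_mult)

lemma gram_form_bounded_linear: "bounded_linear (\<lambda>B :: real^'n^'n. x \<bullet> (B *v x))"
  by (rule bounded_linear_compose[OF bounded_linear_inner_right bounded_linear_matrix_vector_left])

lemma gram_integrable: "integrable N (\<lambda>z. (norm (A z *v x))\<^sup>2)"
  unfolding gram_pointwise
  by (rule integrable_bounded_linear[OF gram_form_bounded_linear gram])

lemma gram_integral: "(\<integral>z. (norm (A z *v x))\<^sup>2 \<partial>N) = x \<bullet> (gram_matrix N A *v x)"
  unfolding gram_pointwise gram_matrix_def
  by (rule integral_bounded_linear[OF gram_form_bounded_linear gram])

lemma gram_symmetric: "transpose (gram_matrix N A) = gram_matrix N A"
proof -
  have "bounded_linear (transpose :: real^'n^'n \<Rightarrow> _)"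
    by (intro linear_conv_bounded_linear[THEN iffD1] linearI)
      (simp_all add: transpose_def vec_eq_iff)
  then have "transpose (gram_matrix N A) = (\<integral>z. transpose (transpose (A z) ** A z) \<partial>N)"
    unfolding gram_matrix_def by (rule integral_bounded_linear[OF _ gram, symmetric])
  then show ?thesis by (simp add: gram_matrix_def matrix_transpose_mul)
qed

lemma gram_kernel:
  assumes "gram_matrix N A *v u = 0"
  shows "AE z in N. A z *v u = 0"
proof -
  have "(\<integral>z. (norm (A z *v u))\<^sup>2 \<partial>N) = 0" by (simp add: gram_integral assms)
  then show ?thesis
    using integral_nonneg_eq_0_iff_AE[OF gram_integrable] by simp
qed

text \<open>The columns of \<open>A\<close> are square-integrable, so \<open>v\<close> is at finite distance from a square-integrable
  field.\<close>

lemma square_integrable_of_finite_error: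
  fixes v :: "'a \<Rightarrow> real^'d"
  assumes [measurable]: "v \<in> borel_measurable N"
    and fin: "(\<integral>\<^sup>+z. ennreal ((norm (v z - A z *v \<xi>))\<^sup>2) \<partial>N) < \<infinity>"
  shows "integrable N (\<lambda>z. (norm (v z))\<^sup>2)"
proof (rule Bochner_Integration.integrable_bound)
  have "integrable N (\<lambda>z. (norm (v z - A z *v \<xi>))\<^sup>2)"
    by (rule integrableI_bounded) (use fin in auto)
  then show "integrable N (\<lambda>z. 2 * (norm (v z - A z *v \<xi>))\<^sup>2 + 2 * (norm (A z *v \<xi>))\<^sup>2)"
    using gram_integrable by simp
  \<comment> \<open>The difference of the two sides is \<open>(norm (a - 2 *\<^sub>R b))\<^sup>2\<close>.\<close>
  have "(norm a)\<^sup>2 \<le> 2 * (norm (a - b))\<^sup>2 + 2 * (norm b)\<^sup>2" for a b :: "real^'d"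
  proof -
    have "0 \<le> (a - 2 *\<^sub>R b) \<bullet> (a - 2 *\<^sub>R b)" by simp
    then show ?thesis
      by (simp add: power2_norm_eq_inner inner_diff_left inner_diff_right inner_commute)
  qed
  then show "AE z in N. norm ((norm (v z))\<^sup>2)
      \<le> norm (2 * (norm (v z - A z *v \<xi>))\<^sup>2 + 2 * (norm (A z *v \<xi>))\<^sup>2)"
    by (intro AE_I2) simp
qed simp

context
  fixes v :: "'a \<Rightarrow> real^'d"
  assumes v_meas [measurable]: "v \<in> borel_measurable N"
    and v_sq: "integrable N (\<lambda>z. (norm (v z))\<^sup>2)"
begin

lemma inner_integrable: "integrable N (\<lambda>z. v z \<bullet> (A z *v x))"
  by (rule integrable_inner_of_squares) (use v_sq gram_integrable in auto)

lemma moment_integrable: "integrable N (\<lambda>z. transpose (A z) *v v z)"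
proof (rule Bochner_Integration.integrable_bound)
  show "integrable N (\<lambda>z. \<Sum>b\<in>Basis. \<bar>v z \<bullet> (A z *v b)\<bar>)"
    using inner_integrable by (intro Bochner_Integration.integrable_sum integrable_abs)
  show "(\<lambda>z. transpose (A z) *v v z) \<in> borel_measurable N"
    by (rule borel_measurable_euclidean_space[THEN iffD2], unfold inner_transpose_mult) measurable
  have "norm (transpose (A z) *v v z) \<le> (\<Sum>b\<in>Basis. \<bar>v z \<bullet> (A z *v b)\<bar>)" for z
    using norm_le_l1[of "transpose (A z) *v v z"] unfolding inner_transpose_mult .
  then show "AE z in N. norm (transpose (A z) *v v z)
      \<le> norm (\<Sum>b\<in>Basis. \<bar>v z \<bullet> (A z *v b)\<bar>)"
    by (intro AE_I2) (simp add: sum_nonneg)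
qed

lemma moment_inner: "moment N A v \<bullet> x = (\<integral>z. v z \<bullet> (A z *v x) \<partial>N)"
  unfolding moment_def inner_transpose_mult[symmetric]
  by (rule integral_bounded_linear[OF bounded_linear_inner_left moment_integrable, symmetric])

text \<open>Solvable even for a singular Gram matrix: if \<open>u\<close> is in its kernel, then \<open>A z *v u\<close> has zero mean
  square, so it vanishes almost everywhere and with it the inner product of \<open>moment N A v\<close> and \<open>u\<close>.\<close>

lemma normal_equations: "gram_matrix N A *v (pseudoinverse (gram_matrix N A) *v moment N A v) = moment N A v"
proof (rule pseudoinverse_solves[OF gram_symmetric])
  fix u assume "gram_matrix N A *v u = 0"
  then have "AE z in N. A z *v u = 0" by (rule gram_kernel)
  then have "AE z in N. v z \<bullet> (A z *v u) = 0" by eventually_elim simp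
  then show "moment N A v \<bullet> u = 0"
    unfolding moment_inner by (rule integral_eq_zero_AE)
qed

lemma least_squares_error:
  "(\<integral>\<^sup>+z. ennreal ((norm (v z - A z *v \<xi>))\<^sup>2) \<partial>N)
    = ennreal ((\<integral>z. (norm (v z))\<^sup>2 \<partial>N) - 2 * (moment N A v \<bullet> \<xi>) + \<xi> \<bullet> (gram_matrix N A *v \<xi>))"
proof -
  have eq: "(norm (v z - A z *v \<xi>))\<^sup>2
      = (norm (v z))\<^sup>2 - 2 * (v z \<bullet> (A z *v \<xi>)) + (norm (A z *v \<xi>))\<^sup>2" for z
    by (simp add: power2_norm_eq_inner inner_diff_left inner_diff_right inner_commute)
  have int: "integrable N (\<lambda>z. (norm (v z - A z *v \<xi>))\<^sup>2)"
    unfolding eq using v_sq inner_integrable gram_integrable by simp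
  have "(\<integral>z. (norm (v z - A z *v \<xi>))\<^sup>2 \<partial>N)
    = (\<integral>z. (norm (v z))\<^sup>2 \<partial>N) - 2 * (moment N A v \<bullet> \<xi>) + \<xi> \<bullet> (gram_matrix N A *v \<xi>)"
    unfolding eq gram_integral[symmetric] moment_inner
    using v_sq inner_integrable gram_integrable by simp
  then show ?thesis using nn_integral_eq_integral[OF int] by simp
qed

text \<open>Completing the square at the solution \<open>\<eta>\<close> of the normal equations: the error at \<open>\<xi>\<close> exceeds
  the left-hand side by the mean square of \<open>A z *v (\<xi> - \<eta>)\<close>.\<close>

lemma least_squares_lower_bound:
  "ennreal ((\<integral>z. (norm (v z))\<^sup>2 \<partial>N) - moment N A v \<bullet> (pseudoinverse (gram_matrix N A) *v moment N A v))
    \<le> (INF \<xi>. \<integral>\<^sup>+z. ennreal ((norm (v z - A z *v \<xi>))\<^sup>2) \<partial>N)"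
proof (rule INF_greatest)
  fix \<xi> :: "real^'n"
  define \<eta> where "\<eta> = pseudoinverse (gram_matrix N A) *v moment N A v"
  have G\<eta>: "gram_matrix N A *v \<eta> = moment N A v" unfolding \<eta>_def by (rule normal_equations)
  have "\<eta> \<bullet> (gram_matrix N A *v \<xi>) = (transpose (gram_matrix N A) *v \<eta>) \<bullet> \<xi>"
    by (simp only: inner_transpose_mult)
  then have cross: "\<eta> \<bullet> (gram_matrix N A *v \<xi>) = moment N A v \<bullet> \<xi>"
    by (simp only: gram_symmetric G\<eta>)
  have "0 \<le> (\<integral>z. (norm (A z *v (\<xi> - \<eta>)))\<^sup>2 \<partial>N)" by simp
  also have "\<dots> = \<xi> \<bullet> (gram_matrix N A *v \<xi>) - 2 * (moment N A v \<bullet> \<xi>) + moment N A v \<bullet> \<eta>"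
    unfolding gram_integral
    by (simp add: matrix_vector_mult_diff_distrib inner_diff_left inner_diff_right G\<eta> cross
        inner_commute)
  finally have "(\<integral>z. (norm (v z))\<^sup>2 \<partial>N) - moment N A v \<bullet> \<eta>
    \<le> (\<integral>z. (norm (v z))\<^sup>2 \<partial>N) - 2 * (moment N A v \<bullet> \<xi>) + \<xi> \<bullet> (gram_matrix N A *v \<xi>)" by simp
  then show "ennreal ((\<integral>z. (norm (v z))\<^sup>2 \<partial>N) - moment N A v \<bullet> (pseudoinverse (gram_matrix N A) *v moment N A v))
    \<le> (\<integral>\<^sup>+z. ennreal ((norm (v z - A z *v \<xi>))\<^sup>2) \<partial>N)"
    unfolding least_squares_error \<eta>_def[symmetric] by (rule ennreal_leI)
qed

end
end

section \<open>Parameterizations and push-forwards\<close>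

lemma parameterization_continuous:
  fixes T :: "real^'n \<Rightarrow> real^'d \<Rightarrow> real^'d"
  assumes C1: "C1_parameterization \<Theta> T J" and \<theta>: "\<theta> \<in> \<Theta>"
  shows "continuous_on UNIV (T \<theta>)" and "continuous_on UNIV (J \<theta>)"
proof -
  obtain D :: "(real^'n) \<times> (real^'d) \<Rightarrow> ((real^'n) \<times> (real^'d)) \<Rightarrow>\<^sub>L (real^'d)" where
    D: "continuous_on (\<Theta> \<times> UNIV) D"
    and der: "\<And>\<theta> z. \<theta> \<in> \<Theta> \<Longrightarrow> ((\<lambda>(\<theta>, z). T \<theta> z) has_derivative blinfun_apply (D (\<theta>, z)))
             (at (\<theta>, z) within \<Theta> \<times> UNIV)"
    and J: "\<And>\<theta> z. \<theta> \<in> \<Theta> \<Longrightarrow> J \<theta> z = matrix (\<lambda>h. blinfun_apply (D (\<theta>, z)) (h, 0))"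
    using C1 unfolding C1_parameterization_def by blast
  have sec: "continuous_on UNIV (\<lambda>z. (\<theta>, z :: real^'d))" by (intro continuous_intros)
  have "continuous_on (\<Theta> \<times> UNIV) (\<lambda>(\<theta>, z). T \<theta> z)"
    unfolding continuous_on_eq_continuous_within
    by (auto dest: der[THEN has_derivative_continuous])
  from continuous_on_compose2[OF this sec] show "continuous_on UNIV (T \<theta>)"
    using \<theta> by auto
  have "continuous_on UNIV (\<lambda>z. D (\<theta>, z))"
    by (rule continuous_on_compose2[OF D sec]) (use \<theta> in auto)
  then have "continuous_on UNIV (\<lambda>z. matrix (\<lambda>h. blinfun_apply (D (\<theta>, z)) (h, 0)))"
    unfolding matrix_def by (intro continuous_intros)
  then show "continuous_on UNIV (J \<theta>)" using J[OF \<theta>] by simp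
qed

text \<open>The defining identity of a push-forward density compares real numbers; nonnegativity and
  integrability of \<open>\<rho>\<close> and finiteness of \<open>M\<close> lift it to an equality of measures.\<close>

lemma pushforward_density_distr:
  fixes T :: "real^'d \<Rightarrow> real^'d"
  assumes "finite_measure M" and sets: "sets M = sets borel"
    and T: "T \<in> borel_measurable M"
    and \<rho>: "\<rho> \<in> prob_densities" and push: "pushforward_density M T \<rho>"
  shows "distr M borel T = density lborel (\<lambda>x. ennreal (\<rho> x))"
proof (rule measure_eqI)
  interpret finite_measure M by fact
  have [measurable]: "\<rho> \<in> borel_measurable borel" and int: "integrable lborel \<rho>"
    and nonneg: "\<And>x. 0 \<le> \<rho> x"
    using \<rho> by (auto simp: prob_densities_def)
  fix E assume "E \<in> sets (distr M borel T)"
  then have E [measurable]: "E \<in> sets borel" by simp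
  have space: "space M = UNIV" using sets_eq_imp_space_eq[OF sets] by simp
  have intE: "integrable lborel (\<lambda>x. indicator E x *\<^sub>R \<rho> x)"
    using integrable_mult_indicator[OF _ int] by simp
  have "emeasure (density lborel (\<lambda>x. ennreal (\<rho> x))) E
      = (\<integral>\<^sup>+x. ennreal (indicator E x *\<^sub>R \<rho> x) \<partial>lborel)"
    by (subst emeasure_density) (auto intro!: nn_integral_cong split: split_indicator)
  also have "\<dots> = ennreal (measure M (T -` E))"
    using push E nonneg by (subst nn_integral_eq_integral[OF intE])
      (auto simp: pushforward_density_def set_lebesgue_integral_def)
  also have "\<dots> = emeasure (distr M borel T) E"
    using T by (simp add: emeasure_distr space emeasure_eq_measure)
  finally show "emeasure (distr M borel T) E = emeasure (density lborel (\<lambda>x. ennreal (\<rho> x))) E" ..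
qed simp

lemma nn_integral_pushforward:
  fixes f :: "real^'d \<Rightarrow> real"
  assumes "finite_measure M" "sets M = sets borel" "T \<in> borel_measurable M"
    and \<rho>: "\<rho> \<in> prob_densities" and "pushforward_density M T \<rho>"
    and f: "f \<in> borel_measurable borel" "\<And>x. 0 \<le> f x"
  shows "(\<integral>\<^sup>+x. ennreal (f x * \<rho> x) \<partial>lborel) = (\<integral>\<^sup>+z. ennreal (f (T z)) \<partial>M)"
proof -
  have [measurable]: "\<rho> \<in> borel_measurable borel" and nonneg: "\<And>x. 0 \<le> \<rho> x"
    using \<rho> by (auto simp: prob_densities_def)
  have "(\<integral>\<^sup>+z. ennreal (f (T z)) \<partial>M) = (\<integral>\<^sup>+x. ennreal (f x) \<partial>distr M borel T)"
    using assms by (subst nn_integral_distr) auto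
  also have "\<dots> = (\<integral>\<^sup>+x. ennreal (\<rho> x) * ennreal (f x) \<partial>lborel)"
    unfolding pushforward_density_distr[OF assms(1-5)]
    using f by (subst nn_integral_density) auto
  also have "\<dots> = (\<integral>\<^sup>+x. ennreal (f x * \<rho> x) \<partial>lborel)"
    using f nonneg by (intro nn_integral_cong) (simp add: ennreal_mult' mult.commute)
  finally show ?thesis ..
qed

section \<open>Dissipation along the flow\<close>

text \<open>The comparison equation \<open>y' = e - \<zeta> y\<close> has the equilibrium \<open>e / \<zeta>\<close>; the deviation from it, scaled
  by the integrating factor \<open>exp (\<zeta> s)\<close>, cannot increase.\<close>

lemma gronwall_affine:
  fixes y y' :: "real \<Rightarrow> real"
  assumes \<zeta>: "\<zeta> > 0" and t: "t \<ge> 0"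
    and der: "\<And>s. s \<ge> 0 \<Longrightarrow> (y has_real_derivative y' s) (at s within {0..})"
    and bound: "\<And>s. s \<ge> 0 \<Longrightarrow> y' s \<le> e - \<zeta> * y s"
  shows "y t \<le> e / \<zeta> * (1 - exp (- \<zeta> * t)) + y 0 * exp (- \<zeta> * t)"
proof -
  define u where "u s = exp (\<zeta> * s) * (y s - e / \<zeta>)" for s
  have u': "(u has_real_derivative exp (\<zeta> * s) * (y' s + \<zeta> * y s - e)) (at s within {0..})"
    if "s \<ge> 0" for s
    unfolding u_def using \<zeta>
    by (auto intro!: derivative_eq_intros der[OF that] simp: field_simps)
  have "u t \<le> u 0"
  proof (rule DERIV_nonpos_imp_decreasing_open[OF t])
    fix s assume s: "0 < s" "s < t"
    then have "at s within {0..} = at s" by (intro at_within_interior) auto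
    then have "DERIV u s :> exp (\<zeta> * s) * (y' s + \<zeta> * y s - e)" using u'[of s] s by simp
    moreover have "exp (\<zeta> * s) * (y' s + \<zeta> * y s - e) \<le> 0"
      using bound[of s] s by (intro mult_nonneg_nonpos) auto
    ultimately show "\<exists>d. DERIV u s :> d \<and> d \<le> 0" by blast
  next
    have "continuous_on {0..} u"
      using u' by (intro DERIV_continuous_on) auto
    then show "continuous_on {0..t} u" by (rule continuous_on_subset) auto
  qed
  then have "exp (- \<zeta> * t) * u t \<le> exp (- \<zeta> * t) * u 0" by (intro mult_left_mono) auto
  moreover have "exp (- \<zeta> * t) * u t = y t - e / \<zeta>"
    by (simp add: u_def mult.assoc[symmetric] exp_add[symmetric])
  ultimately show ?thesis by (simp add: u_def algebra_simps)
qed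

text \<open>The projected flow dissipates at least as fast as the Polyak-Lojasiewicz inequality demands of the
  exact gradient flow, minus the projection error.  Indeed the dissipation integral of the exact flow,
  pulled back to \<open>M\<close>, is the mean square of the field \<open>v\<close>, and by the least-squares bound at most the
  projection error of it is lost.\<close>

lemma projected_dissipation:
  fixes M :: "(real^'d) measure" and \<Theta> :: "(real^'n) set"
  assumes C1_var: "C1_fun (\<phi> (r \<eta>))"
    and zeta_pos: "\<zeta> > 0" and PL: "PL_inequality \<F> \<phi> \<rho>s \<zeta>"
    and M: "finite_measure M" "sets M = sets borel"
    and C1_param: "C1_parameterization \<Theta> T J" and \<eta>: "\<eta> \<in> \<Theta>"
    and push: "r \<eta> \<in> prob_densities" "pushforward_density M (T \<eta>) (r \<eta>)"
    and gram: "integrable M (\<lambda>z. transpose (J \<eta> z) ** J \<eta> z)"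
    and finite_error: "projection_error M \<phi> \<Theta> T J r = ennreal e" "0 \<le> e"
  defines "g \<equiv> param_gradient M \<phi> T J r \<eta>"
  shows "\<zeta> * (\<F> (r \<eta>) - \<F> \<rho>s) - e \<le> g \<bullet> (pseudoinverse (Ghat M J \<eta>) *v g)"
proof -
  define v where "v z = grad (\<phi> (r \<eta>)) (T \<eta> z)" for z
  define err where "err \<xi> = (\<integral>\<^sup>+z. ennreal ((norm (v z - J \<eta> z *v \<xi>))\<^sup>2) \<partial>M)" for \<xi>
  note cont = parameterization_continuous[OF C1_param \<eta>]
  have cont_grad: "continuous_on UNIV (grad (\<phi> (r \<eta>)))"
    using C1_var by (simp add: C1_fun_def)
  have meas: "f \<in> borel_measurable M" if "continuous_on UNIV f"
    for f :: "real^'d \<Rightarrow> 'b::topological_space"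
    using borel_measurable_continuous_onI[OF that] by (simp cong: measurable_cong_sets add: M(2))
  have J: "J \<eta> \<in> borel_measurable M" and T: "T \<eta> \<in> borel_measurable M"
    using cont by (auto intro: meas)
  have v: "v \<in> borel_measurable M"
    unfolding v_def by (intro meas continuous_on_compose2[OF cont_grad cont(1)]) auto
  have Ghat: "Ghat M J \<eta> = gram_matrix M (J \<eta>)" by (simp add: Ghat_def gram_matrix_def)
  have g: "g = moment M (J \<eta>) v" by (simp add: g_def param_gradient_def moment_def v_def)
  have err_le: "(INF \<xi>. err \<xi>) \<le> ennreal e"
    unfolding finite_error(1)[symmetric] projection_error_def err_def v_def
    using \<eta> by (rule SUP_upper)
  then have "(INF \<xi>. err \<xi>) < \<infinity>" using ennreal_less_top[of e] by (simp add: le_less_trans)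
  then obtain \<xi> where "err \<xi> < \<infinity>" by (auto simp: INF_less_iff)
  then have v_sq: "integrable M (\<lambda>z. (norm (v z))\<^sup>2)"
    unfolding err_def by (rule square_integrable_of_finite_error[OF J gram v])
  define V where "V = (\<integral>z. (norm (v z))\<^sup>2 \<partial>M)"
  have "ennreal (V - g \<bullet> (pseudoinverse (Ghat M J \<eta>) *v g)) \<le> (INF \<xi>. err \<xi>)"
    unfolding V_def err_def g Ghat by (rule least_squares_lower_bound[OF J gram v v_sq])
  also note err_le
  finally have projection: "V - g \<bullet> (pseudoinverse (Ghat M J \<eta>) *v g) \<le> e"
    using finite_error(2) by (simp add: ennreal_le_iff)
  have "(\<integral>\<^sup>+x. ennreal ((norm (grad (\<phi> (r \<eta>)) x))\<^sup>2 * r \<eta> x) \<partial>lborel)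
      = (\<integral>\<^sup>+z. ennreal ((norm (v z))\<^sup>2) \<partial>M)"
    unfolding v_def
    by (rule nn_integral_pushforward[OF M T push])
      (auto intro!: borel_measurable_continuous_onI continuous_intros cont_grad)
  also have "\<dots> = ennreal V"
    unfolding V_def by (rule nn_integral_eq_integral[OF v_sq]) simp
  finally have "(\<integral>\<^sup>+x. ennreal ((norm (grad (\<phi> (r \<eta>)) x))\<^sup>2 * r \<eta> x) \<partial>lborel) = ennreal V" .
  moreover have "0 \<le> V" by (simp add: V_def)
  ultimately have "\<F> (r \<eta>) - \<F> \<rho>s \<le> 1 / \<zeta> * V"
    using PL push(1) unfolding PL_inequality_def
    by (auto dest!: bspec[of _ _ "r \<eta>"] simp: enn2ereal_ennreal)
  then have "\<zeta> * (\<F> (r \<eta>) - \<F> \<rho>s) \<le> V" using zeta_pos by (simp add: field_simps)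
  with projection show ?thesis by linarith
qed

theorem theorem3p8:
  fixes \<F> :: "(real^'d \<Rightarrow> real) \<Rightarrow> real"
    and \<phi> :: "(real^'d \<Rightarrow> real) \<Rightarrow> real^'d \<Rightarrow> real"
    and \<rho>s :: "real^'d \<Rightarrow> real"
    and M :: "(real^'d) measure"
    and \<rho>0 :: "real^'d \<Rightarrow> real"
    and \<Theta> :: "(real^'n) set"
    and T :: "real^'n \<Rightarrow> real^'d \<Rightarrow> real^'d"
    and J :: "real^'n \<Rightarrow> real^'d \<Rightarrow> real^'n^'d"
    and r :: "real^'n \<Rightarrow> real^'d \<Rightarrow> real"
    and \<theta> :: "real \<Rightarrow> real^'n"
    and \<zeta> :: real
  assumes first_var: "\<And>\<rho>. \<rho> \<in> prob_densities \<Longrightarrow> first_variation \<F> \<rho> (\<phi> \<rho>) \<and> C1_fun (\<phi> \<rho>)"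
    and gibbs: "gibbs_distribution \<phi> \<rho>s"
    and zeta_pos: "\<zeta> > 0"
    and PL: "PL_inequality \<F> \<phi> \<rho>s \<zeta>"
    and ref_measure: "prob_space M" "M = density lborel (\<lambda>z. ennreal (\<rho>0 z))"
    and ref_density: "\<rho>0 \<in> borel_measurable borel" "\<And>z. 0 \<le> \<rho>0 z"
    and C1_param: "C1_parameterization \<Theta> T J"
    and push: "\<And>\<eta>. \<eta> \<in> \<Theta> \<Longrightarrow> r \<eta> \<in> prob_densities \<and> pushforward_density M (T \<eta>) (r \<eta>)"
    and Ghat_integrable:
      "\<And>\<eta>. \<eta> \<in> \<Theta> \<Longrightarrow> integrable M (\<lambda>z. transpose (J \<eta> z) ** J \<eta> z)"
    and param_gradient:
      "\<And>\<eta>. \<eta> \<in> \<Theta> \<Longrightarrow>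
         ((\<lambda>\<eta>. \<F> (r \<eta>)) has_derivative (\<lambda>h. param_gradient M \<phi> T J r \<eta> \<bullet> h)) (at \<eta> within \<Theta>)"
    and flow_in: "\<And>t. t \<ge> 0 \<Longrightarrow> \<theta> t \<in> \<Theta>"
    and flow:
      "\<And>t. t \<ge> 0 \<Longrightarrow>
         (\<theta> has_vector_derivative
            - (pseudoinverse (Ghat M J (\<theta> t)) *v param_gradient M \<phi> T J r (\<theta> t)))
           (at t within {0..})"
  shows "\<forall>t\<ge>0. ereal (\<F> (r (\<theta> t)) - \<F> \<rho>s)
      \<le> enn2ereal (projection_error M \<phi> \<Theta> T J r) / ereal \<zeta> * ereal (1 - exp (- \<zeta> * t))
         + ereal ((\<F> (r (\<theta> 0)) - \<F> \<rho>s) * exp (- \<zeta> * t))"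
proof (intro allI impI)
  fix t :: real assume t: "t \<ge> 0"
  let ?E = "projection_error M \<phi> \<Theta> T J r"
  let ?g = "\<lambda>s. param_gradient M \<phi> T J r (\<theta> s)"
  let ?d = "\<lambda>s. pseudoinverse (Ghat M J (\<theta> s)) *v ?g s"
  show "ereal (\<F> (r (\<theta> t)) - \<F> \<rho>s)
      \<le> enn2ereal ?E / ereal \<zeta> * ereal (1 - exp (- \<zeta> * t))
         + ereal ((\<F> (r (\<theta> 0)) - \<F> \<rho>s) * exp (- \<zeta> * t))"
  proof (cases ?E)
    case top
    show ?thesis
    proof (cases "t = 0")
      case False
      then have "0 < 1 - exp (- \<zeta> * t)" using t zeta_pos by simp
      then show ?thesis using top zeta_pos by simp
    qed (simp add: zero_ereal_def[symmetric])
  next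
    case (real e)
    have M: "finite_measure M" "sets M = sets borel"
      using ref_measure by (auto intro: prob_space.finite_measure)
    have bound: "\<zeta> * (\<F> (r (\<theta> s)) - \<F> \<rho>s) - e \<le> ?g s \<bullet> ?d s" if "s \<ge> 0" for s
      using projected_dissipation[OF _ zeta_pos PL M C1_param flow_in[OF that] _ _
          Ghat_integrable[OF flow_in[OF that]] real(2,1)]
        first_var push[OF flow_in[OF that]] by blast
    have deriv: "((\<lambda>s. \<F> (r (\<theta> s)) - \<F> \<rho>s) has_real_derivative - (?g s \<bullet> ?d s))
        (at s within {0..})" if s: "s \<ge> 0" for s
    proof -
      have "((\<lambda>s. \<F> (r (\<theta> s))) has_derivative (\<lambda>h. ?g s \<bullet> (h *\<^sub>R - ?d s))) (at s within {0..})"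
      proof (rule has_derivative_in_compose2[where t = \<Theta> and g = "\<lambda>\<eta>. \<F> (r \<eta>)"])
        show "(\<theta> has_derivative (\<lambda>h. h *\<^sub>R - ?d s)) (at s within {0..})"
          using flow[OF s] by (simp add: has_vector_derivative_def)
      qed (use s flow_in param_gradient in auto)
      then show ?thesis
        by (auto intro!: derivative_eq_intros simp: has_field_derivative_def mult.commute fun_eq_iff)
    qed
    have "\<F> (r (\<theta> t)) - \<F> \<rho>s
        \<le> e / \<zeta> * (1 - exp (- \<zeta> * t)) + (\<F> (r (\<theta> 0)) - \<F> \<rho>s) * exp (- \<zeta> * t)"
      by (rule gronwall_affine[OF zeta_pos t deriv]) (use bound in force)+
    then show ?thesis using real zeta_pos by (simp add: enn2ereal_ennreal)
  qed
qed

end
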